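(* Consider running RAC on $n$ data points, where throughout the run every cluster has at most $k$ neighbors ($k\ge 1$), with parallelism factor $P$. Let $\alpha$ and $\beta$ be such that in each round starting with $N$ clusters the number of merges is at least $\alpha N$, and at most a fraction $\beta$ of the non-merging clusters whose neighborhoods are changed in the round need their nearest neighbor updated. If $\alpha=\Omega(1)$ (a constant fraction of nodes merge in each round) and $\beta=\Theta(1/k)$ (a merging pair changes the nearest neighbor of at most a constant number of non-merging nodes), then, in the cost model described in the context, the runtime of RAC is $O\!\left(\frac{n\cdot k}{P}\right)$.
   Context: RAC (Reciprocal Agglomerative Clustering) starts with each of the $n$ data points in its own singleton cluster and proceeds in rounds; in each round, all pairs of reciprocal nearest neighbors in the current set of clusters (pairs each of which is the other's nearest cluster under the linkage function) are simultaneously merged pairwise; it stops when one cluster remains. Dissimilarities are stored sparsely: each cluster stores dissimilarities only to its neighbors, of which there are at most $k$. Cost model: consider a round that starts with $N$ clusters and in which $m$ merges occur. Its total work is the sum of: finding reciprocal nearest neighbors, $O(N)$; sending neighborhoods for the merges, $O(mk)$; merging, $O(mk)$; obtaining information for non-merge updates, $O(mk)$; non-merge updates, $O(mk)$; and updating nearest neighbors: at most $O(\min(N,mk))$ non-merging clusters have their neighborhoods changed, at most a fraction $\beta$ of these have to recompute their nearest neighbor, and each recomputation costs $O(k)$. With parallelism factor $P$ (number of machines/CPUs), the time of a round is its total work divided by $P$. The runtime is the sum of the times over all rounds. *)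

theory Defs
  imports Complex_Main "HOL-Library.Landau_Symbols"
begin

text \<open>
  A cluster is a set of data points.  The sparse storage of dissimilarities is given by a symmetric
  graph \<open>E\<close> on the data points: two clusters are neighbors iff \<open>E\<close> has an edge between
  them, so that a merged cluster inherits the neighborhoods of its two parts.
\<close>

definition neighbors :: "('a \<times> 'a) set \<Rightarrow> 'a set set \<Rightarrow> 'a set \<Rightarrow> 'a set set" where
  "neighbors E S C = {D \<in> S. D \<noteq> C \<and> (\<exists>x\<in>C. \<exists>y\<in>D. (x, y) \<in> E)}"

definition is_nearest ::
  "('a \<times> 'a) set \<Rightarrow> ('a set \<Rightarrow> 'a set \<Rightarrow> real) \<Rightarrow> 'a set set \<Rightarrow> 'a set \<Rightarrow> 'a set \<Rightarrow> bool" where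
  "is_nearest E L S C D \<longleftrightarrow>
     D \<in> neighbors E S C \<and> (\<forall>D'\<in>neighbors E S C. L C D \<le> L C D')"

text \<open>
  A table of nearest neighbors; \<open>None\<close> stands for a cluster without neighbors.  Ties may be
  broken in any way, but every cluster has at most one nearest neighbor in the table, so that the
  reciprocal pairs are disjoint.
\<close>

definition nn_table ::
  "('a \<times> 'a) set \<Rightarrow> ('a set \<Rightarrow> 'a set \<Rightarrow> real) \<Rightarrow> 'a set set \<Rightarrow> ('a set \<Rightarrow> 'a set option) \<Rightarrow> bool" where
  "nn_table E L S nn \<longleftrightarrow>
     (\<forall>C\<in>S. case nn C of None \<Rightarrow> neighbors E S C = {} | Some D \<Rightarrow> is_nearest E L S C D)"

definition reciprocal_pairs :: "'a set set \<Rightarrow> ('a set \<Rightarrow> 'a set option) \<Rightarrow> 'a set set set" where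
  "reciprocal_pairs S nn =
     {{C, D} | C D. C \<in> S \<and> D \<in> S \<and> nn C = Some D \<and> nn D = Some C}"

definition merge_round :: "'a set set \<Rightarrow> ('a set \<Rightarrow> 'a set option) \<Rightarrow> 'a set set" where
  "merge_round S nn = (S - \<Union>(reciprocal_pairs S nn)) \<union> Union ` reciprocal_pairs S nn"

text \<open>
  The fields \<open>clusters r\<close> and \<open>nearest r\<close> describe the state at the start of round \<open>r\<close>
  (rounds are numbered from 0), and for \<open>r = rounds\<close> the final state.
\<close>

record 'a rac =
  points :: "'a set"
  edges :: "('a \<times> 'a) set"
  linkage :: "'a set \<Rightarrow> 'a set \<Rightarrow> real"
  rounds :: nat
  clusters :: "nat \<Rightarrow> 'a set set"
  nearest :: "nat \<Rightarrow> 'a set \<Rightarrow> 'a set option"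

definition rac_run :: "'a rac \<Rightarrow> bool" where
  "rac_run R \<longleftrightarrow>
     finite (points R) \<and> points R \<noteq> {} \<and>
     edges R \<subseteq> points R \<times> points R \<and> sym (edges R) \<and>
     clusters R 0 = (\<lambda>x. {x}) ` points R \<and>
     (\<forall>r\<le>rounds R. nn_table (edges R) (linkage R) (clusters R r) (nearest R r)) \<and>
     (\<forall>r<rounds R. card (clusters R r) > 1 \<and>
        clusters R (Suc r) = merge_round (clusters R r) (nearest R r)) \<and>
     card (clusters R (rounds R)) = 1"

definition num_clusters :: "'a rac \<Rightarrow> nat \<Rightarrow> nat" where
  "num_clusters R r = card (clusters R r)"

definition num_merges :: "'a rac \<Rightarrow> nat \<Rightarrow> nat" where
  "num_merges R r = card (reciprocal_pairs (clusters R r) (nearest R r))"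

definition max_neighbors :: "'a rac \<Rightarrow> nat \<Rightarrow> bool" where
  "max_neighbors R k \<longleftrightarrow>
     (\<forall>r\<le>rounds R. \<forall>C\<in>clusters R r. card (neighbors (edges R) (clusters R r) C) \<le> k)"

definition non_merging :: "'a rac \<Rightarrow> nat \<Rightarrow> 'a set set" where
  "non_merging R r = clusters R r - \<Union>(reciprocal_pairs (clusters R r) (nearest R r))"

definition nbhd_changed :: "'a rac \<Rightarrow> nat \<Rightarrow> 'a set set" where
  "nbhd_changed R r =
     {C \<in> non_merging R r.
        neighbors (edges R) (clusters R (Suc r)) C \<noteq> neighbors (edges R) (clusters R r) C}"

text \<open>
  A cluster whose nearest neighbor takes part in a merge always belongs to the following set, as its
  old nearest neighbor is no longer a cluster.
\<close>

definition nn_updated :: "'a rac \<Rightarrow> nat \<Rightarrow> 'a set set" where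
  "nn_updated R r = {C \<in> nbhd_changed R r. nearest R (Suc r) C \<noteq> nearest R r C}"

text \<open>
  The work spent in each round on the individual phases; \<open>recompute_work r C\<close> is the work of
  recomputing the nearest neighbor of the cluster \<open>C\<close> in round \<open>r\<close>.
\<close>

record 'a rac_work =
  find_work :: "nat \<Rightarrow> real"
  send_work :: "nat \<Rightarrow> real"
  merge_work :: "nat \<Rightarrow> real"
  obtain_work :: "nat \<Rightarrow> real"
  non_merge_work :: "nat \<Rightarrow> real"
  recompute_work :: "nat \<Rightarrow> 'a set \<Rightarrow> real"

text \<open>The real \<open>c\<close> is the constant hidden in the O-bounds of the cost model.\<close>

definition cost_model :: "real \<Rightarrow> 'a rac \<Rightarrow> nat \<Rightarrow> 'a rac_work \<Rightarrow> bool" where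
  "cost_model c R k W \<longleftrightarrow>
     (\<forall>r<rounds R.
        find_work W r \<in> {0..c * real (num_clusters R r)} \<and>
        send_work W r \<in> {0..c * real (num_merges R r * k)} \<and>
        merge_work W r \<in> {0..c * real (num_merges R r * k)} \<and>
        obtain_work W r \<in> {0..c * real (num_merges R r * k)} \<and>
        non_merge_work W r \<in> {0..c * real (num_merges R r * k)} \<and>
        (\<forall>C\<in>nn_updated R r. recompute_work W r C \<in> {0..c * real k}))"

definition round_work :: "'a rac \<Rightarrow> 'a rac_work \<Rightarrow> nat \<Rightarrow> real" where
  "round_work R W r =
     find_work W r + send_work W r + merge_work W r + obtain_work W r + non_merge_work W r +
     (\<Sum>C\<in>nn_updated R r. recompute_work W r C)"

definition runtime :: "'a rac \<Rightarrow> 'a rac_work \<Rightarrow> nat \<Rightarrow> real" where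
  "runtime R W P = (\<Sum>r<rounds R. round_work R W r / real P)"

end

theory Submission
  imports Defs
begin

text \<open>
  Every merge lowers the number of clusters by one, so the merges of all rounds together number fewer
  than \<open>n\<close>.  As a round with \<open>N\<close> clusters has at least \<open>\<alpha> N\<close> merges, the numbers \<open>N\<close> sum up
  to at most \<open>n / \<alpha>\<close>.  A single round costs \<open>O(N k)\<close>: there are at most \<open>N\<close> merges,
  and at most \<open>\<beta> N = O(N / k)\<close> recomputations, at cost \<open>O(k)\<close> each.
\<close>

text \<open>A cluster is never its own neighbor, so the table never sends a cluster to itself and
  the set \<open>{C, D}\<close> cannot collapse to a singleton.\<close>

lemma card_reciprocal_pair:
  assumes "nn_table E L S nn" and "A \<in> reciprocal_pairs S nn"
  shows "card A = 2"
proof -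
  obtain C D where A: "A = {C, D}" and "C \<in> S" "nn C = Some D"
    using assms(2) by (auto simp: reciprocal_pairs_def)
  with assms(1) have "is_nearest E L S C D"
    by (force simp: nn_table_def)
  then have "C \<noteq> D"
    by (auto simp: is_nearest_def neighbors_def)
  then show ?thesis
    using A by simp
qed

text \<open>The table is a function: a cluster lying in a pair determines its partner, hence the
  whole pair.\<close>

lemma pairwise_disjnt_reciprocal_pairs: "pairwise disjnt (reciprocal_pairs S nn)"
  unfolding pairwise_def disjnt_def reciprocal_pairs_def by auto

lemma reciprocal_pairs_subset_Pow: "reciprocal_pairs S nn \<subseteq> Pow S"
  by (auto simp: reciprocal_pairs_def)

lemma finite_reciprocal_pairs: "finite S \<Longrightarrow> finite (reciprocal_pairs S nn)"
  using finite_subset[OF reciprocal_pairs_subset_Pow] by simp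

lemma finite_merge_round: "finite S \<Longrightarrow> finite (merge_round S nn)"
  by (simp add: merge_round_def finite_reciprocal_pairs)

text \<open>With \<open>m\<close> pairs, \<open>2 * m\<close> distinct clusters disappear and at
  most \<open>m\<close> unions take their place. As an inequality this leaves open whether the
  unions are distinct.\<close>

lemma card_merge_round_le:
  assumes "finite S" and "nn_table E L S nn"
  shows "card (merge_round S nn) + card (reciprocal_pairs S nn) \<le> card S"
proof -
  let ?RP = "reciprocal_pairs S nn"
  have sub: "\<Union>?RP \<subseteq> S"
    using reciprocal_pairs_subset_Pow by fast
  have "card (\<Union>?RP) = (\<Sum>A\<in>?RP. card A)"
    using card_Union_disjoint[OF pairwise_disjnt_reciprocal_pairs]
      finite_subset[OF _ assms(1)] reciprocal_pairs_subset_Pow by blast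
  also have "\<dots> = 2 * card ?RP"
    using card_reciprocal_pair[OF assms(2)] by simp
  finally have two: "card (\<Union>?RP) = 2 * card ?RP" .
  have "card (merge_round S nn) \<le> card (S - \<Union>?RP) + card (Union ` ?RP)"
    unfolding merge_round_def by (rule card_Un_le)
  also have "\<dots> \<le> (card S - 2 * card ?RP) + card ?RP"
    using card_Diff_subset[OF finite_subset[OF sub assms(1)] sub] two
      card_image_le[OF finite_reciprocal_pairs[OF assms(1)], of Union] by simp
  \<comment> \<open>The subtraction is truncated on naturals; \<open>2 * m \<le> card S\<close>
    makes it exact.\<close>
  finally show ?thesis
    using card_mono[OF assms(1) sub] two by linarith
qed

lemma finite_clusters:
  assumes "rac_run R" and "r \<le> rounds R"
  shows "finite (clusters R r)"
  using assms(2)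
proof (induction r)
  case 0
  then show ?case
    using assms(1) by (simp add: rac_run_def)
next
  case (Suc r)
  then show ?case
    using assms(1) by (simp add: rac_run_def Suc_le_eq finite_merge_round)
qed

lemma num_clusters_Suc_le:
  assumes "rac_run R" and "r < rounds R"
  shows "num_clusters R (Suc r) + num_merges R r \<le> num_clusters R r"
  using assms
    card_merge_round_le[of "clusters R r" "edges R" "linkage R" "nearest R r"] finite_clusters[of R r]
  by (simp add: rac_run_def num_clusters_def num_merges_def)

lemma num_merges_le: "rac_run R \<Longrightarrow> r < rounds R \<Longrightarrow> num_merges R r \<le> num_clusters R r"
  using num_clusters_Suc_le[of R r] by linarith

text \<open>Telescoping of the one-round bounds, in additive form to avoid subtraction on naturals.
  At the last round it bounds all merges of the run by the number of points.\<close>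

lemma num_clusters_add_sum_num_merges_le:
  assumes "rac_run R" and "r \<le> rounds R"
  shows "num_clusters R r + (\<Sum>s<r. num_merges R s) \<le> card (points R)"
  using assms(2)
proof (induction r)
  case 0
  then show ?case
    using assms(1) by (simp add: rac_run_def num_clusters_def card_image)
next
  case (Suc r)
  then show ?case
    using num_clusters_Suc_le[OF assms(1), of r] by simp
qed

text \<open>Amortization: each merge pays for \<open>1 / a\<close> clusters of its round. This
  avoids a factor for the number of rounds.\<close>

lemma sum_num_clusters_le:
  fixes a :: real
  assumes "rac_run R" and "a > 0"
    and "\<And>r. r < rounds R \<Longrightarrow> a * num_clusters R r \<le> num_merges R r"
  shows "(\<Sum>r<rounds R. real (num_clusters R r)) \<le> card (points R) / a"
proof -
  have "a * (\<Sum>r<rounds R. real (num_clusters R r)) \<le> (\<Sum>r<rounds R. real (num_merges R r))"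
    unfolding sum_distrib_left using assms(3) by (intro sum_mono) simp
  also have "\<dots> \<le> card (points R)"
    using num_clusters_add_sum_num_merges_le[OF assms(1) order_refl]
    by (simp flip: of_nat_sum)
  finally show ?thesis
    using assms(2) by (simp add: pos_le_divide_eq mult.commute)
qed

text \<open>The \<open>N\<close> side of the bound min(N, mk) in the cost model.\<close>

lemma card_nbhd_changed_le:
  assumes "rac_run R" and "r < rounds R"
  shows "card (nbhd_changed R r) \<le> num_clusters R r"
  unfolding num_clusters_def
  using assms by (intro card_mono) (auto simp: finite_clusters nbhd_changed_def non_merging_def)

text \<open>Lets the absolute value in the Landau bound be dropped from the runtime.\<close>

lemma round_work_nonneg:
  assumes "cost_model c R k W" and "r < rounds R"
  shows "round_work R W r \<ge> 0"
  using assms unfolding cost_model_def round_work_def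
  by (auto intro!: add_nonneg_nonneg sum_nonneg)

text \<open>The unit of account is \<open>\<bar>c\<bar> * k * N\<close>: the 5 counts the phases
  other than recomputation, and \<open>B\<close> covers the recomputations. The absolute value
  allows for any sign of \<open>c\<close>.\<close>

lemma round_work_le:
  fixes B c :: real
  assumes run: "rac_run R" and cost: "cost_model c R k W" and r: "r < rounds R"
    and k: "k \<ge> 1" and B: "B \<ge> 0"
    and upd: "real (card (nn_updated R r)) \<le> B / k * card (nbhd_changed R r)"
  shows "round_work R W r \<le> \<bar>c\<bar> * (5 + B) * k * num_clusters R r"
proof -
  let ?N = "real (num_clusters R r)" and ?m = "real (num_merges R r)"
  let ?X = "\<bar>c\<bar> * (k * ?N)"
  have find: "find_work W r \<le> ?X"
  proof -
    have "find_work W r \<le> c * ?N"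
      using cost r by (simp add: cost_model_def)
    also have "\<dots> \<le> \<bar>c\<bar> * (k * ?N)"
      using k by (intro mult_mono) (auto simp: mult_le_cancel_right1)
    finally show ?thesis .
  qed
  \<comment> \<open>The four phases of cost O(mk) share this bound, since there are at most
    \<open>N\<close> merges.\<close>
  have "c * real (num_merges R r * k) \<le> ?X"
    using num_merges_le[OF run r] by (intro mult_mono) (auto simp: mult.commute mult_left_mono)
  with cost r have phases: "send_work W r \<le> ?X" "merge_work W r \<le> ?X" "obtain_work W r \<le> ?X"
    "non_merge_work W r \<le> ?X"
    unfolding cost_model_def by (auto intro: order_trans)
  have "(\<Sum>C\<in>nn_updated R r. recompute_work W r C) \<le> (\<Sum>C\<in>nn_updated R r. \<bar>c\<bar> * k)"
  proof (rule sum_mono)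
    fix C
    assume "C \<in> nn_updated R r"
    then have "recompute_work W r C \<le> c * k"
      using cost r by (simp add: cost_model_def)
    also have "\<dots> \<le> \<bar>c\<bar> * k"
      by (intro mult_right_mono) auto
    finally show "recompute_work W r C \<le> \<bar>c\<bar> * k" .
  qed
  also have "\<dots> = card (nn_updated R r) * (\<bar>c\<bar> * k)"
    by simp
  also have "\<dots> \<le> (B / k * ?N) * (\<bar>c\<bar> * k)"
  proof (rule mult_right_mono)
    have "B / k * card (nbhd_changed R r) \<le> B / k * ?N"
      using card_nbhd_changed_le[OF run r] B by (intro mult_left_mono) auto
    with upd show "card (nn_updated R r) \<le> B / k * ?N"
      by linarith
  qed simp
  \<comment> \<open>The assumption on \<beta> takes effect here: the rate \<open>B / k\<close>
    cancels the cost factor \<open>k\<close> of a recomputation.\<close>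
  also have "\<dots> = B * (\<bar>c\<bar> * ?N)"
    using k by simp
  also have "\<dots> \<le> B * ?X"
    using k B by (intro mult_left_mono) (auto simp: mult_le_cancel_right1)
  finally have "(\<Sum>C\<in>nn_updated R r. recompute_work W r C) \<le> B * ?X" .
  with find phases have "round_work R W r \<le> 5 * ?X + B * ?X"
    by (simp add: round_work_def)
  then show ?thesis
    by (simp add: algebra_simps)
qed

text \<open>Explicit form of the result for one run. The constant depends only on \<open>c\<close>,
  \<open>a\<close> and \<open>B\<close>, so it is uniform over a family of runs.\<close>

lemma abs_runtime_le:
  fixes a B c :: real
  assumes run: "rac_run R" and cost: "cost_model c R k W" and k: "k \<ge> 1"
    and a: "a > 0" "\<And>r. r < rounds R \<Longrightarrow> a * num_clusters R r \<le> num_merges R r"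
    and B: "B \<ge> 0"
      "\<And>r. r < rounds R \<Longrightarrow> card (nn_updated R r) \<le> B / k * card (nbhd_changed R r)"
  shows "\<bar>runtime R W P\<bar> \<le> \<bar>c\<bar> * (5 + B) / a * (card (points R) * k / P)"
proof -
  have "(\<Sum>r<rounds R. round_work R W r) \<le> (\<Sum>r<rounds R. \<bar>c\<bar> * (5 + B) * k * num_clusters R r)"
    using round_work_le[OF run cost _ k B(1)] B(2) by (intro sum_mono) simp
  also have "\<dots> = \<bar>c\<bar> * (5 + B) * k * (\<Sum>r<rounds R. real (num_clusters R r))"
    by (simp add: sum_distrib_left)
  also have "\<dots> \<le> \<bar>c\<bar> * (5 + B) * k * (card (points R) / a)"
    using sum_num_clusters_le[OF run a] B(1) by (intro mult_left_mono) auto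
  finally have "(\<Sum>r<rounds R. round_work R W r) / P
      \<le> \<bar>c\<bar> * (5 + B) * k * (card (points R) / a) / P"
    by (intro divide_right_mono) auto
  moreover have "(\<Sum>r<rounds R. round_work R W r) / P \<ge> 0"
    using round_work_nonneg[OF cost] by (intro divide_nonneg_nonneg sum_nonneg) auto
  ultimately show ?thesis
    by (simp add: runtime_def sum_divide_distrib[symmetric] mult_ac)
qed

theorem theorem9:
  fixes F :: "'i filter"
    and R :: "'i \<Rightarrow> 'a rac"
    and W :: "'i \<Rightarrow> 'a rac_work"
    and n k P :: "'i \<Rightarrow> nat"
    and \<alpha> \<beta> :: "'i \<Rightarrow> real"
    and c :: real
  assumes run: "\<And>i. rac_run (R i)"
    and n: "\<And>i. card (points (R i)) = n i"
    and k: "\<And>i. k i \<ge> 1" "\<And>i. max_neighbors (R i) (k i)"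
    and P: "\<And>i. P i \<ge> 1"
    and cost: "\<And>i. cost_model c (R i) (k i) (W i)"
    and \<alpha>_nonneg: "\<And>i. \<alpha> i \<ge> 0"
    and \<alpha>: "\<And>i r. r < rounds (R i) \<Longrightarrow>
          real (num_merges (R i) r) \<ge> \<alpha> i * real (num_clusters (R i) r)"
    and \<beta>: "\<And>i r. r < rounds (R i) \<Longrightarrow>
          real (card (nn_updated (R i) r)) \<le> \<beta> i * real (card (nbhd_changed (R i) r))"
    and \<alpha>_Omega: "\<alpha> \<in> \<Omega>[F](\<lambda>_. 1)"
    and \<beta>_Theta: "\<beta> \<in> \<Theta>[F](\<lambda>i. 1 / real (k i))"
  shows "(\<lambda>i. runtime (R i) (W i) (P i)) \<in> O[F](\<lambda>i. real (n i) * real (k i) / real (P i))"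
proof -
  obtain a where a: "a > 0" "\<forall>\<^sub>F i in F. norm (\<alpha> i) \<ge> a * norm (1::real)"
    using landau_omega.bigE[OF \<alpha>_Omega] by blast
  \<comment> \<open>The upper half of the Theta bound provides the constant
    \<open>B\<close>.\<close>
  have "\<beta> \<in> O[F](\<lambda>i. 1 / real (k i))"
    using \<beta>_Theta by (rule bigthetaD1)
  then obtain B where B: "B > 0" "\<forall>\<^sub>F i in F. norm (\<beta> i) \<le> B * norm (1 / real (k i))"
    using landau_o.bigE by blast
  have "\<forall>\<^sub>F i in F. norm (runtime (R i) (W i) (P i))
      \<le> \<bar>c\<bar> * (5 + B) / a * norm (real (n i) * real (k i) / real (P i))"
    using a(2) B(2)
  proof eventually_elim
    case (elim i)
    have "a * num_clusters (R i) r \<le> num_merges (R i) r" if "r < rounds (R i)" for r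
    proof -
      \<comment> \<open>The Omega bound concerns the norm of \<open>\<alpha> i\<close>, which is
        \<open>\<alpha> i\<close> itself by nonnegativity.\<close>
      have "a * num_clusters (R i) r \<le> \<alpha> i * num_clusters (R i) r"
        using elim(1) \<alpha>_nonneg[of i] by (intro mult_right_mono) auto
      with \<alpha>[OF that] show ?thesis
        by linarith
    qed
    moreover have "card (nn_updated (R i) r) \<le> B / k i * card (nbhd_changed (R i) r)"
      if "r < rounds (R i)" for r
    proof -
      \<comment> \<open>\<open>\<beta> i\<close> is at most its norm, which is at most
        \<open>B / k i\<close>.\<close>
      have "\<beta> i * card (nbhd_changed (R i) r) \<le> B / k i * card (nbhd_changed (R i) r)"
        using elim(2) by (intro mult_right_mono) auto
      with \<beta>[OF that] show ?thesis
        by linarith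
    qed
    ultimately have "\<bar>runtime (R i) (W i) (P i)\<bar>
        \<le> \<bar>c\<bar> * (5 + B) / a * (card (points (R i)) * k i / P i)"
      using abs_runtime_le[OF run cost k(1) a(1)] B(1) by simp
    then show ?case
      by (simp add: n)
  qed
  then show ?thesis
    by (rule bigoI)
qed

end
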